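(* For $n\ge0$ let $T_n(x,y)=\sum_{i,j\ge0}T(n,i,j)x^iy^j$, where $T(n,i,j)$ is the number of permutations of $[n]$ with $i$ exterior peaks of pattern 132 and $j$ exterior peaks of pattern 231. Then $$\sum_{n=0}^\infty T_n(x,y)\frac{t^n}{n!}=\frac{e^{\frac{x-y}{2}t^2}}{{}_1F_1\left(\frac{1-y}{2(x-y)};\frac12;\frac{x-y}{2}t^2\right)-t\,{}_1F_1\left(\frac12+\frac{1-y}{2(x-y)};\frac32;\frac{x-y}{2}t^2\right)}.$$
   Context: For a permutation $\pi=\pi_1\cdots\pi_n$ of $[n]=\{1,\dots,n\}$ put $\pi_0=0$. An index $1\le i\le n-1$ is an exterior peak if $\pi_{i-1}<\pi_i>\pi_{i+1}$; it is of pattern 132 if moreover $\pi_{i-1}<\pi_{i+1}$, and of pattern 231 if moreover $\pi_{i-1}>\pi_{i+1}$. With $(a)_0=1$ and $(a)_n=a(a+1)\cdots(a+n-1)$, the confluent hypergeometric function is ${}_1F_1(a;b;z)=\sum_{n\ge0}\frac{(a)_n}{(b)_n}\frac{z^n}{n!}$. The identity is one of formal power series in $t$ with coefficients in the field $\mathbb{Q}(x,y)$ of rational functions. The empty permutation is counted for $n=0$. *)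

theory Defs
  imports
    "HOL-Combinatorics.Multiset_Permutations"
    "HOL-Computational_Algebra.Formal_Power_Series"
    "HOL-Computational_Algebra.Fraction_Field"
    "HOL-Computational_Algebra.Polynomial"
begin

text \<open>
  A permutation of \<open>[n]\<close> is represented by its word, an element of
  \<open>permutations_of_set {1..n}\<close>; prefixing the word with \<open>0\<close> gives \<open>\<pi>\<^sub>0 = 0\<close>
  and makes positions agree with the usual indices \<open>1, \<dots>, n\<close>.
\<close>

definition letter :: "nat list \<Rightarrow> nat \<Rightarrow> nat" where
  "letter w i = (0 # w) ! i"

definition exterior_peak :: "nat list \<Rightarrow> nat \<Rightarrow> bool" where
  "exterior_peak w i \<longleftrightarrow>
     1 \<le> i \<and> i < length w \<and> letter w (i - 1) < letter w i \<and> letter w i > letter w (i + 1)"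

definition peaks132 :: "nat list \<Rightarrow> nat set" where
  "peaks132 w = {i. exterior_peak w i \<and> letter w (i - 1) < letter w (i + 1)}"

definition peaks231 :: "nat list \<Rightarrow> nat set" where
  "peaks231 w = {i. exterior_peak w i \<and> letter w (i - 1) > letter w (i + 1)}"

definition T :: "nat \<Rightarrow> nat \<Rightarrow> nat \<Rightarrow> nat" where
  "T n i j = card {w \<in> permutations_of_set {1..n}. card (peaks132 w) = i \<and> card (peaks231 w) = j}"

lemma T_eq_0:
  assumes "n < i \<or> n < j"
  shows "T n i j = 0"
proof -
  have "card (peaks132 w) \<le> length w \<and> card (peaks231 w) \<le> length w" for w
  proof -
    have "peaks132 w \<subseteq> {1..length w}" "peaks231 w \<subseteq> {1..length w}"
      by (auto simp: peaks132_def peaks231_def exterior_peak_def)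
    from this[THEN card_mono[rotated]] show ?thesis by simp
  qed
  moreover have "length w = n" if "w \<in> permutations_of_set {1..n}" for w
    using length_finite_permutations_of_set[OF that] by simp
  ultimately have "{w \<in> permutations_of_set {1..n}. card (peaks132 w) = i \<and> card (peaks231 w) = j} = {}"
    using assms by (fastforce simp: not_less[symmetric])
  then show ?thesis by (simp add: T_def del: Collect_empty_eq)
qed

text \<open>The field \<open>\<rat>(x,y)\<close>, as the fraction field of \<open>\<rat>[x][y]\<close>.\<close>

type_synonym ratfun = "rat poly poly fract"

definition x_var :: ratfun where
  "x_var = Fract [:[:0, 1:]:] 1"

definition y_var :: ratfun where
  "y_var = Fract [:0, 1:] 1"

text \<open>By \<open>T_eq_0\<close>, the range \<open>i, j \<le> n\<close> contains every nonzero term of the sum over all \<open>i, j \<ge> 0\<close>.\<close>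

definition T_poly :: "nat \<Rightarrow> ratfun \<Rightarrow> ratfun \<Rightarrow> ratfun" where
  "T_poly n x y = (\<Sum>i\<le>n. \<Sum>j\<le>n. of_nat (T n i j) * x ^ i * y ^ j)"

text \<open>
  The third argument is a power series, substituted into \<open>\<^sub>1F\<^sub>1(a; b; z)\<close>; the substitution
  is meaningful only if its constant term vanishes.
\<close>

definition hyp1F1 :: "'a::field_char_0 \<Rightarrow> 'a \<Rightarrow> 'a fps \<Rightarrow> 'a fps" where
  "hyp1F1 a b z = fps_hypergeo [a] [b] 1 oo z"

lemma hyp1F1_X_nth:
  "fps_nth (hyp1F1 a b fps_X) n = pochhammer a n / pochhammer b n * (1 / fact n)"
  by (simp add: hyp1F1_def)

end

theory Submission
  imports Defs
begin

text \<open>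
  Cut a word at its least letter \<open>m\<close>, say \<open>w = u m v\<close>. Preceded by a smaller letter, \<open>w\<close> falls
  apart into \<open>u\<close>, framed by two smaller letters, and \<open>v\<close>, preceded by the smaller letter \<open>m\<close>;
  whether a position is a peak, and of which pattern, is decided inside one of the two parts,
  because \<open>m\<close> itself is not a peak. For the exponential generating functions \<open>F\<close> of the words
  preceded by a smaller letter and \<open>L\<close> of the words with a smaller letter at each end, the left one
  the smaller of the two, this gives \<open>F' = F L\<close>.

  The same cut applies to a framed word. Exchanging the order of the two frame letters matters
  only for words of a single letter, whose peak it turns from pattern 132 into pattern 231:
  the last letter of a longer word has on its left a letter larger than the frame, so a peak
  there is 231 in both cases, and likewise a peak at the first letter is always 132. Hence words
  with \<open>m\<close> on the left and a letter below \<open>m\<close> on the right have generating function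
  \<open>L - (x - y) t\<close>. The only framed word that does not split multiplicatively at \<open>m\<close> is the
  word \<open>m\<close>, which weighs \<open>x\<close> instead of \<open>1\<close>.
  So \<open>L' = L (L - (x - y) t) + (x - 1)\<close>, a Riccati equation.

  The substitution \<open>L = (x - y) t - D' / D\<close> makes it linear:
  \<open>D'' = (x - y) t D' + (1 - y) D\<close> with \<open>D(0) = 1\<close> and \<open>D'(0) = -1\<close>.
  In the variable \<open>(x - y) t\<^sup>2 / 2\<close> this is Kummer's equation, and the denominator of the
  asserted formula is its solution with these initial values. Then
  \<open>F' / F = (x - y) t - D' / D\<close> integrates to \<open>F = exp ((x - y) t\<^sup>2 / 2) / D\<close>.

  The argument is run backwards to avoid solving equations: \<open>F\<close> and \<open>L\<close> are defined by
  their closed forms, the two differential equations are checked for them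
  (\<open>word_series_deriv\<close>, \<open>framed_series_deriv\<close>), and an induction on the number of letters shows
  that their coefficients are the weighted counts (\<open>word_weight_sum\<close>, \<open>framed_weight_sum\<close>),
  the equations being the recurrences that the cut at the least letter gives.
\<close>

unbundle fps_syntax

section \<open>Kummer's equation and the two generating functions\<close>

lemma kummer_equation:
  fixes a b :: "'a::field_char_0"
  assumes b: "\<And>n. b + of_nat n \<noteq> 0"
  defines "M \<equiv> fps_hypergeo [a] [b] 1"
  shows "fps_X * fps_deriv (fps_deriv M) + (fps_const b - fps_X) * fps_deriv M = fps_const a * M"
proof (rule fps_ext)
  fix n
  have step: "of_nat (Suc n) * (b + of_nat n) * M $ Suc n = (a + of_nat n) * M $ n" for n
  proof -
    have "(b + of_nat n) * of_nat (Suc n) \<noteq> 0"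
      using b[of n] by (simp del: of_nat_Suc)
    moreover have "M $ Suc n = (a + of_nat n) / ((b + of_nat n) * of_nat (Suc n)) * M $ n"
      by (simp add: M_def fps_hypergeo_rec mult_ac del: of_nat_Suc fps_hypergeo_nth)
    ultimately have "(b + of_nat n) * of_nat (Suc n) * M $ Suc n = (a + of_nat n) * M $ n"
      by simp
    then show ?thesis
      by (simp only: mult_ac)
  qed
  show "(fps_X * fps_deriv (fps_deriv M) + (fps_const b - fps_X) * fps_deriv M) $ n = (fps_const a * M) $ n"
  proof (cases n)
    case 0
    then show ?thesis using step[of 0] by (simp add: algebra_simps)
  next
    case (Suc m)
    then show ?thesis using step[of n] by (simp add: algebra_simps)
  qed
qed

text \<open>
  Kummer's equation after substituting \<open>c t\<^sup>2\<close>, as a first-order system in the composite and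
  \<open>N\<close>, the substituted derivative of the hypergeometric series. The second derivative of the
  composite is \<open>2 c (N + t N')\<close>, so the combination \<open>t N'\<close> is the one to be expressed by the rest.
\<close>

lemma hyp1F1_compose_equation:
  fixes a b c :: "'a::field_char_0"
  assumes b: "\<And>n. b + of_nat n \<noteq> 0"
  defines "z \<equiv> fps_const c * fps_X ^ 2"
  obtains N where
    "fps_deriv (hyp1F1 a b z) = 2 * fps_const c * fps_X * N"
    "fps_X * fps_deriv N + 2 * (fps_const b - z) * N = 2 * fps_const a * hyp1F1 a b z"
proof -
  let ?M = "fps_hypergeo [a] [b] 1"
  let ?N = "fps_deriv ?M oo z"
  have z0: "z $ 0 = 0" by (simp add: z_def)
  have dz: "fps_deriv z = 2 * fps_const c * fps_X"
    by (simp add: z_def fps_deriv_power power2_eq_square)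
  have 1: "fps_deriv (hyp1F1 a b z) = 2 * fps_const c * fps_X * ?N"
    using fps_compose_deriv[OF z0, of ?M] by (simp add: hyp1F1_def dz mult_ac)
  have "z * (fps_deriv (fps_deriv ?M) oo z) + (fps_const b - z) * ?N = fps_const a * hyp1F1 a b z"
    using arg_cong[OF kummer_equation[OF b, of a], of "\<lambda>f. f oo z"]
    by (simp add: fps_compose_add_distrib fps_compose_sub_distrib z0 fps_compose_mult_distrib[OF z0] hyp1F1_def)
  moreover have "fps_X * fps_deriv ?N = 2 * z * (fps_deriv (fps_deriv ?M) oo z)"
    using fps_compose_deriv[OF z0, of "fps_deriv ?M"]
    by (simp add: dz) (simp add: z_def power2_eq_square mult_ac)
  ultimately have 2: "fps_X * fps_deriv ?N + 2 * (fps_const b - z) * ?N = 2 * fps_const a * hyp1F1 a b z"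
    by algebra
  show ?thesis using that[OF 1 2] .
qed

definition kummer_denominator :: "'a::field_char_0 \<Rightarrow> 'a \<Rightarrow> 'a fps" where
  "kummer_denominator x y =
    (let z = fps_const ((x - y) / 2) * fps_X ^ 2; a = (1 - y) / (2 * (x - y))
     in hyp1F1 a (1 / 2) z - fps_X * hyp1F1 (1 / 2 + a) (3 / 2) z)"

lemma half_plus_nat_nonzero:
  "1 / 2 + of_nat n \<noteq> (0::'a::field_char_0)" "3 / 2 + of_nat n \<noteq> (0::'a::field_char_0)"
proof -
  have *: "of_nat (Suc k) / 2 + of_nat n \<noteq> (0::'a)" for k n
  proof
    assume "of_nat (Suc k) / 2 + of_nat n = (0::'a)"
    then have "of_nat (Suc k + 2 * n) = (0::'a)"
      by (simp add: field_simps)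
    then show False unfolding of_nat_eq_0_iff by simp
  qed
  show "1 / 2 + of_nat n \<noteq> (0::'a)" "3 / 2 + of_nat n \<noteq> (0::'a)"
    using *[of 0 n] *[of 2 n] by (simp_all add: numeral_3_eq_3)
qed

lemma kummer_denominator_nth:
  "kummer_denominator x y $ 0 = 1" "kummer_denominator x y $ 1 = -1"
proof -
  have zero: "hyp1F1 a b (fps_const c * fps_X ^ 2) $ 0 = 1" for a b c :: 'a
    by (simp add: hyp1F1_def fps_compose_nth)
  have one: "hyp1F1 a b (fps_const c * fps_X ^ 2) $ 1 = 0" if nz: "\<And>n. b + of_nat n \<noteq> 0" for a b c :: 'a
  proof -
    obtain N where N: "fps_deriv (hyp1F1 a b (fps_const c * fps_X ^ 2)) = 2 * fps_const c * fps_X * N"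
      using hyp1F1_compose_equation[OF nz, of a c] by metis
    show ?thesis
      using arg_cong[OF N, of "\<lambda>f. f $ 0"] by simp
  qed
  show "kummer_denominator x y $ 0 = 1" "kummer_denominator x y $ 1 = -1"
    using one[OF half_plus_nat_nonzero(1)] by (simp_all add: kummer_denominator_def Let_def zero)
qed

text \<open>
  The two summands are the even and the odd solution of one linear equation: the factor \<open>t\<close> and
  the parameters raised by \<open>1 / 2\<close> and \<open>1\<close> turn one standard solution of Kummer's equation
  at \<open>0\<close> into the other.
\<close>

lemma kummer_denominator_equation:
  fixes x y :: "'a::field_char_0"
  assumes "x \<noteq> y"
  defines "D \<equiv> kummer_denominator x y"
  shows "fps_deriv (fps_deriv D) = fps_const (x - y) * fps_X * fps_deriv D + fps_const (1 - y) * D"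
proof -
  define c where "c = (x - y) / 2"
  define a where "a = (1 - y) / (2 * (x - y))"
  define z where "z = fps_const c * fps_X ^ 2"
  define U where "U = hyp1F1 a (1 / 2) z"
  define V where "V = hyp1F1 (1 / 2 + a) (3 / 2) z"
  have D: "D = U - fps_X * V"
    by (simp only: D_def kummer_denominator_def U_def V_def z_def a_def c_def Let_def)
  obtain N where N: "fps_deriv U = 2 * fps_const c * fps_X * N"
    "fps_X * fps_deriv N + 2 * (fps_const (1 / 2) - z) * N = 2 * fps_const a * U"
    using hyp1F1_compose_equation[OF half_plus_nat_nonzero(1)] unfolding U_def z_def by metis
  obtain P where P: "fps_deriv V = 2 * fps_const c * fps_X * P"
    "fps_X * fps_deriv P + 2 * (fps_const (3 / 2) - z) * P = 2 * fps_const (1 / 2 + a) * V"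
    using hyp1F1_compose_equation[OF half_plus_nat_nonzero(2)] unfolding V_def z_def by metis
  have half: "2 * fps_const (1 / 2) = (1 :: 'a fps)" "2 * fps_const (3 / 2) = (3 :: 'a fps)"
    by (simp_all add: numeral_fps_const)
  have coeffs: "fps_const (x - y) = 2 * fps_const c" "fps_const (1 - y) = 4 * fps_const a * fps_const c"
    "fps_const (1 / 2 + a) = fps_const (1 / 2) + fps_const a"
  proof -
    have "2 * c = x - y" "4 * a * c = 1 - y"
      using assms(1) by (simp_all add: a_def c_def divide_simps) (simp_all add: algebra_simps)
    then show "fps_const (x - y) = 2 * fps_const c" "fps_const (1 - y) = 4 * fps_const a * fps_const c"
      unfolding numeral_fps_const fps_const_mult by simp_all
  qed simp
  have U2: "fps_deriv (fps_deriv U) = 2 * fps_const c * (N + fps_X * fps_deriv N)"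
    by (simp add: N(1) algebra_simps)
  have V2: "fps_deriv (fps_deriv V) = 2 * fps_const c * (P + fps_X * fps_deriv P)"
    by (simp add: P(1) algebra_simps)
  have D1: "fps_deriv D = fps_deriv U - V - fps_X * fps_deriv V"
    by (simp add: D)
  have D2: "fps_deriv (fps_deriv D) = fps_deriv (fps_deriv U) - 2 * fps_deriv V - fps_X * fps_deriv (fps_deriv V)"
    by (simp add: D)
  show ?thesis
    unfolding D2 unfolding U2 V2 D1 unfolding N(1) P(1) unfolding D coeffs(1,2)
    using N(2) P(2) half z_def coeffs(3) by algebra
qed

text \<open>
  The closed forms of \<open>F\<close> and \<open>L\<close>. Here \<open>framed_series x y\<close> is the logarithmic derivative of
  \<open>word_series x y\<close>.
\<close>

definition word_series :: "'a::field_char_0 \<Rightarrow> 'a \<Rightarrow> 'a fps" where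
  "word_series x y = (fps_exp 1 oo (fps_const ((x - y) / 2) * fps_X ^ 2)) / kummer_denominator x y"

definition framed_series :: "'a::field_char_0 \<Rightarrow> 'a \<Rightarrow> 'a fps" where
  "framed_series x y = fps_const (x - y) * fps_X - fps_deriv (kummer_denominator x y) / kummer_denominator x y"

lemma framed_series_nth_0: "framed_series x y $ 0 = 1"
  by (simp add: framed_series_def fps_divide_unit kummer_denominator_nth kummer_denominator_nth(2)[simplified])

lemma word_series_nth_0: "word_series x y $ 0 = 1"
  by (simp add: word_series_def fps_divide_unit kummer_denominator_nth) 

lemma word_series_deriv:
  "fps_deriv (word_series x y) = word_series x y * framed_series x y"
proof -
  define D where "D = kummer_denominator x y"
  define z where "z = fps_const ((x - y) / 2) * fps_X ^ 2"
  define E where "E = fps_exp 1 oo z"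
  have D0: "D $ 0 \<noteq> 0" by (simp add: D_def kummer_denominator_nth)
  have "fps_deriv E = E * fps_deriv z"
    unfolding E_def by (subst fps_compose_deriv) (simp_all add: z_def)
  moreover have "fps_deriv z = fps_const (x - y) * fps_X"
  proof -
    have "2 * ((x - y) / 2) = x - y" by (simp add: field_simps)
    then have "fps_const (x - y) = 2 * fps_const ((x - y) / 2)"
      by (simp only: numeral_fps_const fps_const_mult)
    then show ?thesis by (simp add: z_def fps_deriv_power power2_eq_square)
  qed
  ultimately have dE: "fps_deriv E = E * (fps_const (x - y) * fps_X)" by simp
  have W: "word_series x y = E * inverse D" "framed_series x y = fps_const (x - y) * fps_X - fps_deriv D * inverse D"
    using D0 by (simp_all add: word_series_def framed_series_def E_def D_def z_def fps_divide_unit)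
  show ?thesis
    unfolding W by (simp add: dE fps_inverse_deriv[OF D0] algebra_simps power2_eq_square)
qed

text \<open>
  The linear equation of second order for the denominator is equivalent to a Riccati equation
  for its logarithmic derivative.
\<close>

lemma framed_series_deriv:
  fixes x y :: "'a::field_char_0"
  assumes "x \<noteq> y"
  defines "L \<equiv> framed_series x y"
  shows "fps_deriv L = L * (L - fps_const (x - y) * fps_X) + fps_const (x - 1)"
proof -
  define D where "D = kummer_denominator x y"
  have D0: "D $ 0 \<noteq> 0" by (simp add: D_def kummer_denominator_nth)
  have L: "L = fps_const (x - y) * fps_X - fps_deriv D * inverse D"
    using D0 by (simp add: L_def framed_series_def D_def fps_divide_unit)
  have inv: "inverse D * D = 1" using D0 by (rule inverse_mult_eq_1)
  have D2: "fps_deriv (fps_deriv D) = fps_const (x - y) * fps_X * fps_deriv D + fps_const (1 - y) * D"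
    unfolding D_def by (rule kummer_denominator_equation[OF assms(1)])
  have "fps_const (x - y) = fps_const (x - 1) + fps_const (1 - y)" by simp
  moreover have "fps_deriv L = fps_const (x - y) - (fps_deriv (fps_deriv D) * inverse D - fps_deriv D * fps_deriv D * (inverse D)\<^sup>2)"
    unfolding L by (simp add: fps_inverse_deriv[OF D0] algebra_simps power2_eq_square)
  ultimately show ?thesis
    using inv L D2 by algebra
qed

section \<open>Weights of words\<close>

text \<open>
  The weight of a word counts the peaks at its inner letters, so the letters that precede or
  follow a word are written as part of it. With \<open>0\<close> in front, the peaks are the exterior ones
  (\<open>word_weight_peaks\<close>).
\<close>

definition peak_weight :: "'a::comm_ring_1 \<Rightarrow> 'a \<Rightarrow> nat \<Rightarrow> nat \<Rightarrow> nat \<Rightarrow> 'a" where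
  "peak_weight x y p m q = (if p < m \<and> q < m then if p < q then x else y else 1)"

fun word_weight :: "'a::comm_ring_1 \<Rightarrow> 'a \<Rightarrow> nat list \<Rightarrow> 'a" where
  "word_weight x y (p # m # q # w) = peak_weight x y p m q * word_weight x y (m # q # w)"
| "word_weight x y _ = 1"

lemma word_weight_split:
  "word_weight x y (u @ p # m # q # v) =
    word_weight x y (u @ [p, m]) * peak_weight x y p m q * word_weight x y (m # q # v)"
proof (induction u)
  case Nil
  then show ?case by simp
next
  case (Cons a u)
  then show ?case 
    by (cases u; cases "tl u") (simp_all add: mult_ac)
qed

text \<open>
  The least letter \<open>m\<close> has a larger neighbour as soon as the word has another letter, so it is no
  peak and contributes a factor \<open>1\<close>. For the one-letter word the neighbours are the frame
  letters \<open>a\<close> and \<open>b\<close>, and \<open>m\<close> may be a peak.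
\<close>

lemma word_weight_split_framed:
  assumes "u \<noteq> [] \<or> v \<noteq> []"
    and "\<forall>k\<in>set u. m < k" and "\<forall>k\<in>set v. m < k"
  shows "word_weight x y (a # u @ m # v @ [b]) =
    word_weight x y (a # u @ [m]) * word_weight x y (m # v @ [b])"
proof -
  obtain u' p where u': "a # u = u' @ [p]" by (metis append_butlast_last_id list.distinct(1))
  obtain q v' where v': "v @ [b] = q # v'" by (cases "v @ [b]") auto
  have "m < p \<or> m < q"
  proof (cases v)
    case Nil
    then have "u \<noteq> []" using assms(1) by blast
    then have "p \<in> set u" using u' by (metis last_ConsR last_in_set last_snoc)
    then show ?thesis using assms(2) by blast
  next
    case Cons
    then show ?thesis using v' assms(3) by auto
  qed
  then have "peak_weight x y p m q = 1" by (auto simp: peak_weight_def)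
  then show ?thesis
    using word_weight_split[of x y u' p m q v'] u' v' by (metis append.assoc append_Cons append_Nil mult.right_neutral)
qed

text \<open>Without a letter at the right end, \<open>m\<close> is either the last letter or followed by a larger one.\<close>

lemma word_weight_split_min:
  assumes "\<forall>k\<in>set v. m < k"
  shows "word_weight x y (a # u @ m # v) = word_weight x y (a # u @ [m]) * word_weight x y (m # v)"
proof (cases v)
  case Nil
  then show ?thesis by simp
next
  case (Cons q v')
  obtain u' p where u': "a # u = u' @ [p]" by (metis append_butlast_last_id list.distinct(1))
  have "peak_weight x y p m q = 1" using assms Cons by (auto simp: peak_weight_def)
  then show ?thesis
    using word_weight_split[of x y u' p m q v'] u' Cons by (metis append.assoc append_Cons append_Nil mult.right_neutral)
qed

text \<open>
  Distinctness excludes peaks whose two neighbours agree, which \<open>peak_weight\<close> would count as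
  peaks of pattern 231.
\<close>

lemma word_weight_peaks:
  assumes "distinct (0 # w)"
  shows "word_weight x y (0 # w) = x ^ card (peaks132 w) * y ^ card (peaks231 w)"
proof -
  have prod: "word_weight x y v = (\<Prod>k<length v - 2. peak_weight x y (v ! k) (v ! Suc k) (v ! Suc (Suc k)))" for v
    by (induction x y v rule: word_weight.induct) (simp_all add: prod.lessThan_Suc_shift del: prod.lessThan_Suc)
  let ?v = "0 # w"
  let ?A = "{..<length ?v - 2}"
  (* The peak at position Suc k is the middle of the three letters starting at k. *)
  have p132: "peaks132 w = Suc ` {k\<in>?A. ?v ! k < ?v ! Suc k \<and> ?v ! Suc (Suc k) < ?v ! Suc k \<and> ?v ! k < ?v ! Suc (Suc k)}"
  proof (rule set_eqI)
    fix i show "i \<in> peaks132 w \<longleftrightarrow> i \<in> Suc ` {k\<in>?A. ?v ! k < ?v ! Suc k \<and> ?v ! Suc (Suc k) < ?v ! Suc k \<and> ?v ! k < ?v ! Suc (Suc k)}"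
      by (cases i) (auto simp: peaks132_def exterior_peak_def letter_def)
  qed
  have p231: "peaks231 w = Suc ` {k\<in>?A. ?v ! k < ?v ! Suc k \<and> ?v ! Suc (Suc k) < ?v ! Suc k \<and> \<not> ?v ! k < ?v ! Suc (Suc k)}"
  proof (rule set_eqI)
    fix i
    have "?v ! k \<noteq> w ! Suc k" if "Suc k < length w" for k
      using assms that nth_eq_iff_index_eq[of ?v k "Suc (Suc k)"] by simp
    then have "w ! Suc k < ?v ! k \<longleftrightarrow> \<not> ?v ! k < w ! Suc k" if "Suc k < length w" for k
      using that by (meson linorder_neqE_nat less_asym)
    then show "i \<in> peaks231 w \<longleftrightarrow> i \<in> Suc ` {k\<in>?A. ?v ! k < ?v ! Suc k \<and> ?v ! Suc (Suc k) < ?v ! Suc k \<and> \<not> ?v ! k < ?v ! Suc (Suc k)}"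
      by (cases i) (auto simp: peaks231_def exterior_peak_def letter_def)
  qed
  have split: "peak_weight x y p m q = (if p < m \<and> q < m \<and> p < q then x else 1) * (if p < m \<and> q < m \<and> \<not> p < q then y else 1)" for p m q
    by (auto simp: peak_weight_def)
  have pow: "(\<Prod>k\<in>?A. if P k then c else 1) = c ^ card {k\<in>?A. P k}" for P and c :: 'a
    by (simp flip: prod.inter_filter)
  show ?thesis
    unfolding prod split prod.distrib pow p132 p231 by (simp add: card_image)
qed

section \<open>Cutting permutations at a letter\<close>

lemma sum_permutations_split:
  assumes "m \<in> S" "finite S"
  shows "(\<Sum>w\<in>permutations_of_set S. g w) =
    (\<Sum>B\<in>Pow (S - {m}). \<Sum>u\<in>permutations_of_set B. \<Sum>v\<in>permutations_of_set (S - {m} - B). g (u @ m # v))"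
proof -
  have fin: "finite (S - {m})" using assms by simp
  have "(\<Sum>w\<in>permutations_of_set S. g w) =
    (\<Sum>(B, u, v)\<in>(SIGMA B:Pow (S - {m}). permutations_of_set B \<times> permutations_of_set (S - {m} - B)). g (u @ m # v))"
  proof (rule sum.reindex_bij_witness[where i = "\<lambda>(B, u, v). u @ m # v"
        and j = "\<lambda>w. (set (takeWhile (\<lambda>k. k \<noteq> m) w), takeWhile (\<lambda>k. k \<noteq> m) w, tl (dropWhile (\<lambda>k. k \<noteq> m) w))"])
    fix w assume "w \<in> permutations_of_set S"
    then have w: "m \<in> set w" "distinct w" "set w = S" using assms by (auto simp: permutations_of_set_def)
    then obtain u v where uv: "w = u @ m # v" "m \<notin> set u" by (metis split_list_first)
    then have split: "takeWhile (\<lambda>k. k \<noteq> m) w = u" "dropWhile (\<lambda>k. k \<noteq> m) w = m # v"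
      by (induction u arbitrary: w) auto
    have "distinct u" "distinct v" "m \<notin> set v" "set u \<inter> set v = {}" "S = insert m (set u \<union> set v)"
      using w uv by auto
    then show "(case (set (takeWhile (\<lambda>k. k \<noteq> m) w), takeWhile (\<lambda>k. k \<noteq> m) w, tl (dropWhile (\<lambda>k. k \<noteq> m) w)) of (B, u, v) \<Rightarrow> u @ m # v) = w"
      "(set (takeWhile (\<lambda>k. k \<noteq> m) w), takeWhile (\<lambda>k. k \<noteq> m) w, tl (dropWhile (\<lambda>k. k \<noteq> m) w))
        \<in> (SIGMA B:Pow (S - {m}). permutations_of_set B \<times> permutations_of_set (S - {m} - B))"
      "(case (set (takeWhile (\<lambda>k. k \<noteq> m) w), takeWhile (\<lambda>k. k \<noteq> m) w, tl (dropWhile (\<lambda>k. k \<noteq> m) w)) of (B, u, v) \<Rightarrow> g (u @ m # v)) = g w"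
      unfolding split using uv by (auto simp: permutations_of_set_def)
  next
    fix t assume "t \<in> (SIGMA B:Pow (S - {m}). permutations_of_set B \<times> permutations_of_set (S - {m} - B))"
    then obtain B u v where t: "t = (B, u, v)" "B \<subseteq> S - {m}" "set u = B" "distinct u" "set v = S - {m} - B" "distinct v"
      by (auto simp: permutations_of_set_def)
    then have "m \<notin> set u" by auto
    then have "takeWhile (\<lambda>k. k \<noteq> m) (u @ m # v) = u" "dropWhile (\<lambda>k. k \<noteq> m) (u @ m # v) = m # v"
      by (induction u) auto
    with t show "(set (takeWhile (\<lambda>k. k \<noteq> m) (case t of (B, u, v) \<Rightarrow> u @ m # v)), takeWhile (\<lambda>k. k \<noteq> m) (case t of (B, u, v) \<Rightarrow> u @ m # v),
        tl (dropWhile (\<lambda>k. k \<noteq> m) (case t of (B, u, v) \<Rightarrow> u @ m # v))) = t"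
      by simp
    show "(case t of (B, u, v) \<Rightarrow> u @ m # v) \<in> permutations_of_set S"
      using t assms by (auto simp: permutations_of_set_def)
  qed
  also have "\<dots> = (\<Sum>B\<in>Pow (S - {m}). \<Sum>u\<in>permutations_of_set B. \<Sum>v\<in>permutations_of_set (S - {m} - B). g (u @ m # v))"
    using fin by (simp add: sum.Sigma finite_subset)
  finally show ?thesis .
qed

lemma sum_Pow_card:
  fixes h :: "nat \<Rightarrow> 'a::comm_semiring_1"
  assumes "finite S"
  shows "(\<Sum>B\<in>Pow S. h (card B)) = (\<Sum>k\<le>card S. of_nat (card S choose k) * h k)"
proof -
  have "(\<Sum>B\<in>Pow S. h (card B)) = (\<Sum>k\<le>card S. \<Sum>B\<in>{B\<in>Pow S. card B = k}. h (card B))"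
    using assms by (intro sum.group[symmetric]) (auto intro: card_mono)
  also have "\<dots> = (\<Sum>k\<le>card S. of_nat (card S choose k) * h k)"
    using n_subsets[OF assms] by (intro sum.cong) simp_all
  finally show ?thesis .
qed

text \<open>
  The product formula for exponential generating functions, for permutations cut at a fixed
  letter \<open>m\<close>: the sums over the words on either side depend only on the number of letters, and
  the choice of the letters to the left gives the binomial coefficients.
\<close>

lemma sum_permutations_convolution:
  fixes f g :: "nat list \<Rightarrow> 'a::field_char_0" and A B :: "'a fps"
  assumes "m \<in> S" "finite S"
  assumes "\<And>R. R \<subseteq> S - {m} \<Longrightarrow> (\<Sum>u\<in>permutations_of_set R. f u) = fact (card R) * A $ card R"
  assumes "\<And>R. R \<subseteq> S - {m} \<Longrightarrow> (\<Sum>u\<in>permutations_of_set R. g u) = fact (card R) * B $ card R"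
  assumes "\<And>u v. set u \<subseteq> S - {m} \<Longrightarrow> set v = S - {m} - set u \<Longrightarrow> h (u @ m # v) = f u * g v"
  shows "(\<Sum>w\<in>permutations_of_set S. h w) = fact (card S - 1) * (A * B) $ (card S - 1)"
proof -
  let ?S = "S - {m}" and ?n = "card S - 1"
  have n: "card ?S = ?n" and fin: "finite ?S" using assms(1,2) by simp_all
  have "(\<Sum>w\<in>permutations_of_set S. h w) =
    (\<Sum>R\<in>Pow ?S. \<Sum>u\<in>permutations_of_set R. \<Sum>v\<in>permutations_of_set (?S - R). f u * g v)"
    unfolding sum_permutations_split[OF assms(1,2)]
    by (intro sum.cong refl assms(5)) (auto simp: permutations_of_set_def)
  also have "\<dots> = (\<Sum>R\<in>Pow ?S. (fact (card R) * A $ card R) * (fact (?n - card R) * B $ (?n - card R)))"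
  proof (intro sum.cong refl)
    fix R assume R: "R \<in> Pow ?S"
    then have "card (?S - R) = ?n - card R"
      using n fin by (metis PowD card_Diff_subset finite_subset)
    then show "(\<Sum>u\<in>permutations_of_set R. \<Sum>v\<in>permutations_of_set (?S - R). f u * g v) =
        (fact (card R) * A $ card R) * (fact (?n - card R) * B $ (?n - card R))"
      using assms(3)[of R] assms(4)[of "?S - R"] R by (simp add: sum_product[symmetric])
  qed
  also have "\<dots> = (\<Sum>k\<le>?n. of_nat (?n choose k) * ((fact k * A $ k) * (fact (?n - k) * B $ (?n - k))))"
    using sum_Pow_card[OF fin, of "\<lambda>k. (fact k * A $ k) * (fact (?n - k) * B $ (?n - k))"] n by simp
  also have "\<dots> = (\<Sum>k\<le>?n. fact ?n * (A $ k * B $ (?n - k)))"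
  proof (intro sum.cong refl)
    fix k assume "k \<in> {..?n}"
    then have "of_nat (?n choose k) = (fact ?n / (fact k * fact (?n - k)) :: 'a)"
      by (intro binomial_fact) simp
    then show "of_nat (?n choose k) * ((fact k * A $ k) * (fact (?n - k) * B $ (?n - k))) = fact ?n * (A $ k * B $ (?n - k))"
      by simp
  qed
  also have "\<dots> = fact ?n * (A * B) $ ?n"
    by (simp add: fps_mult_nth sum_distrib_left atLeast0AtMost)
  finally show ?thesis .
qed

section \<open>Counting words by weight\<close>

text \<open>
  In the induction the right frame letter of \<open>u\<close> is the least letter \<open>m\<close>, which lies above \<open>a\<close>,
  while the left frame letter of \<open>v\<close> is \<open>m\<close>, which lies above \<open>b\<close>. So both orders of the frame
  letters occur whatever the order of \<open>a\<close> and \<open>b\<close>, and they have to be treated together.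
\<close>

lemma framed_weight_sum:
  fixes x y :: "'a::field_char_0"
  assumes "x \<noteq> y"
  defines "L \<equiv> framed_series x y"
  assumes "finite S" "a \<noteq> b" "\<forall>k\<in>S. a < k \<and> b < k"
  shows "(\<Sum>w\<in>permutations_of_set S. word_weight x y (a # w @ [b])) =
    fact (card S) * (if a < b then L else L - fps_const (x - y) * fps_X) $ card S"
  using assms(3-5)
proof (induction "card S" arbitrary: S a b rule: less_induct)
  case less
  have ode: "of_nat (Suc n) * L $ Suc n = (L * (L - fps_const (x - y) * fps_X)) $ n + fps_const (x - 1) $ n" for n
    using arg_cong[OF framed_series_deriv[OF assms(1)], of "\<lambda>f. f $ n"] by (simp add: L_def)
  have L0: "L $ 0 = 1" by (simp add: L_def framed_series_nth_0)
  show ?case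
  proof (cases "card S \<le> 1")
    case True
    show ?thesis
    proof (cases "S = {}")
      case True
      then show ?thesis by (simp add: L0)
    next
      case False
      with \<open>card S \<le> 1\<close> \<open>finite S\<close> have "card S = 1" by (simp add: le_Suc_eq)
      then obtain m where m: "S = {m}" by (auto simp: card_1_singleton_iff)
      (* Here the middle letter is a peak, of pattern 132 or 231 according to the order of a and b. *)
      have "L $ 1 = x" using ode[of 0] L0 by simp
      then show ?thesis using less.prems m by (auto simp: peak_weight_def permutations_of_set_singleton)
    qed
  next
    case False
    define m where "m = Min S"
    have ne: "S \<noteq> {}" using False by auto
    have m: "m \<in> S" "\<And>k. k \<in> S - {m} \<Longrightarrow> m < k"
      using less.prems(1) ne unfolding m_def by (auto simp: order.not_eq_order_implies_strict)
    have smaller: "card R < card S" "finite R" if "R \<subseteq> S - {m}" for R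
      using that m(1) less.prems(1) by (auto intro!: psubset_card_mono intro: finite_subset)
    have "(\<Sum>w\<in>permutations_of_set S. word_weight x y (a # w @ [b])) =
      fact (card S - 1) * (L * (L - fps_const (x - y) * fps_X)) $ (card S - 1)"
    proof (rule sum_permutations_convolution[OF m(1) less.prems(1)])
      fix R assume R: "R \<subseteq> S - {m}"
      have "a < m" "b < m" using m(1) less.prems(3) by auto
      have gt: "\<forall>k\<in>R. a < k \<and> b < k \<and> m < k" using R m(2) less.prems(3) by auto
      show "(\<Sum>u\<in>permutations_of_set R. word_weight x y (a # u @ [m])) = fact (card R) * L $ card R"
        using less.hyps[OF smaller[OF R], of a m] \<open>a < m\<close> gt by simp
      show "(\<Sum>v\<in>permutations_of_set R. word_weight x y (m # v @ [b])) =
          fact (card R) * (L - fps_const (x - y) * fps_X) $ card R"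
        using less.hyps[OF smaller[OF R], of m b] \<open>b < m\<close> gt by simp
    next
      fix u v assume uv: "set u \<subseteq> S - {m}" "set v = S - {m} - set u"
      have "S \<subseteq> {m} \<union> set u \<union> set v" using uv by blast
      with False have "u \<noteq> [] \<or> v \<noteq> []" using m(1) by (auto simp: subset_singleton_iff)
      then show "word_weight x y (a # (u @ m # v) @ [b]) = word_weight x y (a # u @ [m]) * word_weight x y (m # v @ [b])"
        using word_weight_split_framed[of u v m x y a b] uv m(2) by auto
    qed
    also obtain n where n: "card S = Suc (Suc n)" using False by (metis One_nat_def not_less_eq_eq Suc_le_D)
    have "fact (card S - 1) * (L * (L - fps_const (x - y) * fps_X)) $ (card S - 1) = fact (card S) * L $ card S"
    proof -
      have "(L * (L - fps_const (x - y) * fps_X)) $ Suc n = of_nat (Suc (Suc n)) * L $ Suc (Suc n)"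
        using ode[of "Suc n"] by (simp del: of_nat_Suc)
      then show ?thesis unfolding n by (simp add: fact_Suc[of "Suc n"] mult_ac del: of_nat_Suc fact_Suc)
    qed
    (* The correction (x - y) t does not reach the coefficients of degree at least 2. *)
    finally show ?thesis using n by simp
  qed
qed

lemma word_weight_sum:
  fixes x y :: "'a::field_char_0"
  assumes "x \<noteq> y"
  assumes "finite S" "\<forall>k\<in>S. a < k"
  shows "(\<Sum>w\<in>permutations_of_set S. word_weight x y (a # w)) = fact (card S) * word_series x y $ card S"
  using assms(2-3)
proof (induction "card S" arbitrary: S a rule: less_induct)
  case less
  let ?F = "word_series x y" and ?L = "framed_series x y"
  show ?case
  proof (cases "S = {}")
    case True
    then show ?thesis by (simp add: word_series_nth_0)
  next
    case False
    define m where "m = Min S"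
    have m: "m \<in> S" "\<And>k. k \<in> S - {m} \<Longrightarrow> m < k"
      using less.prems(1) False unfolding m_def by (auto simp: order.not_eq_order_implies_strict)
    have smaller: "card R < card S" "finite R" if "R \<subseteq> S - {m}" for R
      using that m(1) less.prems(1) by (auto intro!: psubset_card_mono intro: finite_subset)
    have "(\<Sum>w\<in>permutations_of_set S. word_weight x y (a # w)) = fact (card S - 1) * (?L * ?F) $ (card S - 1)"
    proof (rule sum_permutations_convolution[OF m(1) less.prems(1)])
      fix R assume R: "R \<subseteq> S - {m}"
      have gt: "\<forall>k\<in>R. a < k \<and> m < k" "a < m" using R m less.prems(2) by auto
      show "(\<Sum>u\<in>permutations_of_set R. word_weight x y (a # u @ [m])) = fact (card R) * ?L $ card R"
        using framed_weight_sum[OF assms(1) smaller(2)[OF R], of a m] gt by simp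
      show "(\<Sum>v\<in>permutations_of_set R. word_weight x y (m # v)) = fact (card R) * ?F $ card R"
        using less.hyps[OF smaller[OF R], of m] gt by simp
    next
      fix u v assume uv: "set u \<subseteq> S - {m}" "set v = S - {m} - set u"
      show "word_weight x y (a # u @ m # v) = word_weight x y (a # u @ [m]) * word_weight x y (m # v)"
        using word_weight_split_min[of v m x y a u] uv m(2) by auto
    qed
    also obtain n where n: "card S = Suc n" using False less.prems(1) by (metis card_0_eq not0_implies_Suc)
    have "fact (card S - 1) * (?L * ?F) $ (card S - 1) = fact (card S) * ?F $ card S"
      using arg_cong[OF word_series_deriv[of x y], of "\<lambda>f. f $ n"] n by (simp add: mult_ac)
    finally show ?thesis .
  qed
qed

lemma T_poly_eq_sum:
  "T_poly n x y = (\<Sum>w\<in>permutations_of_set {1..n}. word_weight x y (0 # w))"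
proof -
  let ?P = "permutations_of_set {1..n}"
  have bound: "card (peaks132 w) \<le> n" "card (peaks231 w) \<le> n" if "w \<in> ?P" for w
  proof -
    have "T n (card (peaks132 w)) (card (peaks231 w)) \<noteq> 0"
      using that by (auto simp: T_def card_eq_0_iff)
    with T_eq_0 show "card (peaks132 w) \<le> n" "card (peaks231 w) \<le> n" by (meson not_less)+
  qed
  let ?f = "\<lambda>w. (card (peaks132 w), card (peaks231 w))"
  have fibre: "of_nat (T n (fst t) (snd t)) * x ^ fst t * y ^ snd t =
      (\<Sum>w\<in>{w\<in>?P. ?f w = t}. x ^ card (peaks132 w) * y ^ card (peaks231 w))" for t
  proof -
    have "(\<Sum>w\<in>{w\<in>?P. ?f w = t}. x ^ card (peaks132 w) * y ^ card (peaks231 w)) =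
        (\<Sum>w\<in>{w\<in>?P. ?f w = t}. x ^ fst t * y ^ snd t)"
      by (intro sum.cong) auto
    moreover have "{w\<in>?P. ?f w = t} = {w\<in>?P. card (peaks132 w) = fst t \<and> card (peaks231 w) = snd t}"
      by (auto simp: prod_eq_iff)
    ultimately show ?thesis by (simp only: T_def sum_constant mult.assoc)
  qed
  have "T_poly n x y = (\<Sum>t\<in>{..n} \<times> {..n}. of_nat (T n (fst t) (snd t)) * x ^ fst t * y ^ snd t)"
    by (simp only: T_poly_def sum.cartesian_product case_prod_unfold)
  also have "\<dots> = (\<Sum>w\<in>?P. x ^ card (peaks132 w) * y ^ card (peaks231 w))"
    unfolding fibre by (rule sum.group) (use bound in \<open>auto\<close>)
  also have "\<dots> = (\<Sum>w\<in>?P. word_weight x y (0 # w))"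
    by (intro sum.cong refl word_weight_peaks[symmetric]) (auto simp: permutations_of_set_def)
  finally show ?thesis .
qed

lemma x_var_neq_y_var: "x_var \<noteq> y_var"
  by (simp add: x_var_def y_var_def eq_fract)

theorem theorem1p7:
  fixes x y :: ratfun and z :: "ratfun fps"
  defines "x \<equiv> x_var" and "y \<equiv> y_var"
  defines "z \<equiv> fps_const ((x - y) / 2) * fps_X ^ 2"
  shows "Abs_fps (\<lambda>n. T_poly n x y / fact n) =
    (fps_exp 1 oo z) /
    (hyp1F1 ((1 - y) / (2 * (x - y))) (1 / 2) z
       - fps_X * hyp1F1 (1 / 2 + (1 - y) / (2 * (x - y))) (3 / 2) z)"
proof -
  have "T_poly n x y / fact n = word_series x y $ n" for n
    using word_weight_sum[OF x_var_neq_y_var, of "{1..n}" 0] by (simp add: T_poly_eq_sum x_def y_def)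
  then have "Abs_fps (\<lambda>n. T_poly n x y / fact n) = word_series x y"
    by (simp add: fps_eq_iff)
  then show ?thesis
    by (simp only: word_series_def kummer_denominator_def Let_def z_def)
qed

end
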